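(* Let $\alpha\in[0,1)\cup[5,\infty)$. Then for every finitely supported function $u:\mathbb{N}_0\to\mathbb{R}$ with $u(0)=0$, $$\sum_{n=1}^\infty |u(n)-u(n-1)|^2 n^\alpha \;\ge\; \frac{(\alpha-1)^2}{4}\sum_{n=1}^\infty \frac{|u(n)|^2}{n^2}\,n^\alpha .$$ Moreover, the constant $(\alpha-1)^2/4$ is sharp: if it is replaced by any strictly larger constant, the inequality fails for some such $u$.
   Context: $\mathbb{N}_0=\{0,1,2,\dots\}$. *)

theory Defs
  imports "HOL-Analysis.Analysis"
begin

end

theory Submission
  imports Defs "HOL-Real_Asymp.Real_Asymp"
begin

text \<open>
  For a positive sequence \<open>v\<close> with ratios \<open>q n = v n / v (n - 1)\<close>, the ground state inequality
  \<open>(x - y)\<^sup>2 \<ge> (1 - 1 / q) x\<^sup>2 + (1 - q) y\<^sup>2\<close> reduces the Hardy inequality to a pointwise condition on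
  \<open>q\<close>. The natural choice for \<open>v\<close>, \<open>n\<close> to the power \<open>c = (1 - \<alpha>) / 2\<close>, leads to awkward conditions; quotients of
  rising factorials with the same growth need only Bernoulli's inequality:
  \<open>q n = (n - 1 + c) / (n - 1)\<close> for \<open>\<alpha> < 1\<close>, and \<open>q n = n / (n + b)\<close> with \<open>b = - c\<close> for \<open>\<alpha> \<ge> 3\<close>.
  For sharpness, \<open>n\<close> to the power \<open>c\<close> makes both sums grow like the harmonic numbers, with ratio
  \<open>c\<^sup>2\<close> between the rates, while a linear cutoff between \<open>N\<close> and \<open>2 N\<close> costs only a bounded amount.
\<close>

section \<open>Finitely supported sums and telescoping\<close>

lemma infsum_atLeast1_eq_sum:
  fixes f :: "nat \<Rightarrow> real"
  assumes "\<And>n. n > M \<Longrightarrow> f n = 0"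
  shows "(\<Sum>\<^sub>\<infinity>n\<in>{1..}. f n) = (\<Sum>n=1..M. f n)"
proof -
  have "(\<Sum>\<^sub>\<infinity>n\<in>{1..}. f n) = (\<Sum>\<^sub>\<infinity>n\<in>{1..M}. f n)"
    by (rule infsum_cong_neutral) (use assms in auto)
  then show ?thesis by simp
qed

lemma finite_support_bound:
  fixes u :: "nat \<Rightarrow> real"
  assumes "finite {n. u n \<noteq> 0}"
  obtains M where "\<And>n. n \<ge> M \<Longrightarrow> u n = 0"
proof -
  obtain M where "\<forall>n\<in>{n. u n \<noteq> 0}. n < M"
    using assms finite_nat_set_iff_bounded by blast
  then have "\<And>n. n \<ge> M \<Longrightarrow> u n = 0"
    by (meson leD mem_Collect_eq)
  then show ?thesis using that by blast
qed

lemma sum_ge_of_telescoping: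
  fixes a b P :: "nat \<Rightarrow> real"
  assumes "\<And>n. n \<ge> 1 \<Longrightarrow> a n \<ge> b n + (P n - P (n - 1))"
  shows "(\<Sum>n=1..M. a n) \<ge> (\<Sum>n=1..M. b n) + (P M - P 0)"
proof (induction M)
  case (Suc M)
  show ?case using Suc.IH assms[of "Suc M"] by simp
qed simp

text \<open>Here \<open>w\<close> is the weight of the energy, \<open>h\<close> the Hardy weight and
  \<open>p\<close> a free potential. The terms \<open>p n * (u n)\<^sup>2\<close> telescope, and
  both boundary terms vanish: one because the support is finite, the other because
  \<open>u 0 = 0\<close>, whatever the value of \<open>p 0\<close>.\<close>

lemma infsum_le_of_telescoping:
  fixes u w h p :: "nat \<Rightarrow> real"
  assumes "finite {n. u n \<noteq> 0}" and u0: "u 0 = 0"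
    and step: "\<And>n. n \<ge> 1 \<Longrightarrow>
      w n * (u n - u (n - 1))\<^sup>2 \<ge> (h n + p n) * (u n)\<^sup>2 - p (n - 1) * (u (n - 1))\<^sup>2"
  shows "(\<Sum>\<^sub>\<infinity>n\<in>{1..}. w n * (u n - u (n - 1))\<^sup>2) \<ge> (\<Sum>\<^sub>\<infinity>n\<in>{1..}. h n * (u n)\<^sup>2)"
proof -
  obtain M where M: "\<And>n. n \<ge> M \<Longrightarrow> u n = 0"
    using finite_support_bound assms(1) by blast
  have "(\<Sum>n=1..M. w n * (u n - u (n - 1))\<^sup>2) \<ge>
      (\<Sum>n=1..M. h n * (u n)\<^sup>2) + (p M * (u M)\<^sup>2 - p 0 * (u 0)\<^sup>2)"
    by (rule sum_ge_of_telescoping[where P = "\<lambda>n. p n * (u n)\<^sup>2"])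
      (use step in \<open>simp add: algebra_simps\<close>)
  moreover have "(\<Sum>\<^sub>\<infinity>n\<in>{1..}. w n * (u n - u (n - 1))\<^sup>2) = (\<Sum>n=1..M. w n * (u n - u (n - 1))\<^sup>2)"
    by (rule infsum_atLeast1_eq_sum) (use M in auto)
  moreover have "(\<Sum>\<^sub>\<infinity>n\<in>{1..}. h n * (u n)\<^sup>2) = (\<Sum>n=1..M. h n * (u n)\<^sup>2)"
    by (rule infsum_atLeast1_eq_sum) (use M in auto)
  ultimately show ?thesis using M[of M] u0 by simp
qed

section \<open>Elementary real inequalities\<close>

text \<open>The difference of the two sides is the square \<open>(x - q * y)\<^sup>2 / q\<close>; it
  vanishes exactly when \<open>x / y\<close> follows the ratio \<open>q\<close> of the ground
  state.\<close>

lemma square_diff_ge_weighted: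
  fixes x y q :: real
  assumes "q > 0"
  shows "(x - y)\<^sup>2 \<ge> (1 - 1 / q) * x\<^sup>2 + (1 - q) * y\<^sup>2"
proof -
  have "(x - y)\<^sup>2 - ((1 - 1 / q) * x\<^sup>2 + (1 - q) * y\<^sup>2) = (x - q * y)\<^sup>2 / q"
    using assms by (simp add: field_simps power2_eq_square)
  then show ?thesis using assms
    by (smt (verit) divide_nonneg_pos zero_le_power2)
qed

lemma powr_ge_one_plus:
  fixes x a :: real
  assumes "x \<ge> 0" "a \<ge> 1"
  shows "(1 + x) powr a \<ge> 1 + a * x"
proof -
  have "(1 + 0) powr a - a * 0 \<le> (1 + x) powr a - a * x"
  proof (rule DERIV_nonneg_imp_nondecreasing[OF assms(1)])
    fix t :: real assume t: "0 \<le> t" "t \<le> x"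
    have "((\<lambda>t. (1 + t) powr a - a * t) has_real_derivative a * (1 + t) powr (a - 1) - a) (at t)"
      using t by (auto intro!: derivative_eq_intros)
    moreover have "a * (1 + t) powr (a - 1) - a \<ge> 0"
      using assms t mult_left_mono[OF ge_one_powr_ge_zero[of "1 + t" "a - 1"], of a] by simp
    ultimately show "\<exists>y. ((\<lambda>t. (1 + t) powr a - a * t) has_real_derivative y) (at t) \<and> 0 \<le> y"
      by blast
  qed
  then show ?thesis by simp
qed

lemma powr_le_one_plus:
  fixes x a :: real
  assumes "x \<ge> 0" "0 \<le> a" "a \<le> 1"
  shows "(1 + x) powr a \<le> 1 + a * x"
proof (cases "a = 0")
  case False
  \<comment> \<open>The exponent \<open>1 / a\<close> is at least 1, so the convex case at the point
    \<open>a * x\<close> gives \<open>1 + x\<close> as a lower bound of the base.\<close>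
  have "((1 + a * x) powr (1 / a)) powr a \<ge> (1 + x) powr a"
    using powr_ge_one_plus[of "a * x" "1 / a"] assms False
    by (intro powr_mono2) auto
  then show ?thesis using assms False by (simp add: powr_powr)
qed (use assms in auto)

lemma powr_Suc_ratio:
  fixes m a :: real
  assumes "m > 0"
  shows "(m + 1) powr a = m powr a * (1 + 1 / m) powr a"
proof -
  have "m + 1 = m * (1 + 1 / m)" using assms by (simp add: field_simps)
  then show ?thesis using assms by (metis add_pos_pos less_imp_le powr_mult zero_less_divide_1_iff zero_less_one)
qed

section \<open>Pointwise conditions on the ground state ratios\<close>

text \<open>For \<open>q n = (n - 1 + c) / (n - 1)\<close> the square of \<open>u m\<close> receives
  \<open>c / (m - 1 + c)\<close> times the weight at \<open>m\<close> and loses \<open>c / m\<close>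
  times the weight at \<open>m + 1\<close>. Bernoulli for the exponent \<open>1 - 2*c\<close> in
  [0,1) bounds the loss; what remains is a rational inequality with an explicit nonnegative
  gap.\<close>

lemma hardy_coefficient_small:
  fixes m c :: real
  assumes m: "m \<ge> 1" and c: "0 < c" "c \<le> 1/2"
  shows "c\<^sup>2 * (m powr (1 - 2*c) / m\<^sup>2) + (m + 1) powr (1 - 2*c) * (c / m)
    \<le> m powr (1 - 2*c) * (c / (m - 1 + c))"
proof -
  have "(1 + 1/m) powr (1 - 2*c) \<le> 1 + (1 - 2*c) * (1/m)"
    by (rule powr_le_one_plus) (use m c in auto)
  then have "c\<^sup>2 / m\<^sup>2 + (1 + 1/m) powr (1 - 2*c) * (c / m) \<le> c\<^sup>2 / m\<^sup>2 + (1 + (1 - 2*c) * (1/m)) * (c / m)"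
    using m c by (intro add_left_mono mult_right_mono) auto
  also have "\<dots> \<le> c / (m - 1 + c)"
  proof -
    have "c / (m - 1 + c) - (c\<^sup>2 / m\<^sup>2 + (1 + (1 - 2*c) * (1/m)) * (c / m))
        = c * (1 - c)\<^sup>2 / (m\<^sup>2 * (m - 1 + c))"
      using m c by (simp add: field_simps power2_eq_square)
    also have "\<dots> \<ge> 0" using m c by auto
    finally show ?thesis by simp
  qed
  finally have "m powr (1 - 2*c) * (c\<^sup>2 / m\<^sup>2 + (1 + 1/m) powr (1 - 2*c) * (c / m))
      \<le> m powr (1 - 2*c) * (c / (m - 1 + c))"
    by (intro mult_left_mono) auto
  moreover have "(m + 1) powr A = m powr A * (1 + 1/m) powr A" for A
    using m by (simp add: powr_Suc_ratio)
  ultimately show ?thesis by (simp add: distrib_left mult_ac)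
qed

text \<open>For \<open>q n = n / (n + b)\<close> the signs are reversed: the step at
  \<open>m\<close> costs \<open>b / m\<close> and the step at \<open>m + 1\<close> gains
  \<open>b / (m + 1 + b)\<close>. Splitting the exponent as \<open>b + (1 + b)\<close>, with both
  parts at least 1, allows Bernoulli twice, and the second factor cancels the denominator
  \<open>m + 1 + b\<close>.\<close>

lemma hardy_coefficient_large:
  fixes m b :: real
  assumes m: "m \<ge> 1" and b: "1 \<le> b"
  shows "b\<^sup>2 * (m powr (1 + 2*b) / m\<^sup>2) + m powr (1 + 2*b) * (b / m)
    \<le> (m + 1) powr (1 + 2*b) * (b / (m + 1 + b))"
proof -
  have "(1 + b * (1/m)) * (1 + (1 + b) * (1/m)) \<le> (1 + 1/m) powr b * (1 + 1/m) powr (1 + b)"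
    by (intro mult_mono powr_ge_one_plus) (use m b in auto)
  also have "\<dots> = (1 + 1/m) powr (1 + 2*b)"
    by (simp flip: powr_add add: algebra_simps)
  finally have "(1 + b * (1/m)) * (1 + (1 + b) * (1/m)) * (b / (m + 1 + b))
      \<le> (1 + 1/m) powr (1 + 2*b) * (b / (m + 1 + b))"
    using m b by (intro mult_right_mono) auto
  moreover have "(1 + b * (1/m)) * (1 + (1 + b) * (1/m)) * (b / (m + 1 + b)) = b\<^sup>2 / m\<^sup>2 + b / m"
  proof -
    have "1 + (1 + b) * (1/m) = (m + 1 + b) / m" using m by (simp add: field_simps)
    then have "(1 + b * (1/m)) * (1 + (1 + b) * (1/m)) * (b / (m + 1 + b)) = (1 + b * (1/m)) * (b / m)"
      using m b by simp
    then show ?thesis by (simp add: algebra_simps power2_eq_square)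
  qed
  ultimately have "m powr (1 + 2*b) * (b\<^sup>2 / m\<^sup>2 + b / m)
      \<le> m powr (1 + 2*b) * ((1 + 1/m) powr (1 + 2*b) * (b / (m + 1 + b)))"
    by (intro mult_left_mono) auto
  moreover have "(m + 1) powr A = m powr A * (1 + 1/m) powr A" for A
    using m by (simp add: powr_Suc_ratio)
  ultimately show ?thesis by (simp add: distrib_left mult_ac)
qed

section \<open>The Hardy inequality in the two ranges\<close>

lemma hardy_small:
  fixes u :: "nat \<Rightarrow> real"
  assumes fin: "finite {n. u n \<noteq> 0}" and u0: "u 0 = 0" and c: "0 < c" "c \<le> 1/2"
  shows "(\<Sum>\<^sub>\<infinity>n\<in>{1..}. real n powr (1 - 2*c) * (u n - u (n - 1))\<^sup>2)
    \<ge> (\<Sum>\<^sub>\<infinity>n\<in>{1..}. c\<^sup>2 * (real n powr (1 - 2*c) / (real n)\<^sup>2) * (u n)\<^sup>2)"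
\<comment> \<open>The potential \<open>p n\<close> is the loss \<open>- (1 - q (n + 1))\<close>
  times the weight at \<open>n + 1\<close>. At \<open>n = 0\<close> the division by zero gives
  0.\<close>
proof (rule infsum_le_of_telescoping[OF fin u0,
    where p = "\<lambda>n. (real n + 1) powr (1 - 2*c) * (c / real n)"])
  fix n :: nat assume n: "n \<ge> 1"
  let ?w = "real n powr (1 - 2*c)"
  have "(c\<^sup>2 * (?w / (real n)\<^sup>2) + (real n + 1) powr (1 - 2*c) * (c / real n)) * (u n)\<^sup>2
      \<le> ?w * (c / (real n - 1 + c)) * (u n)\<^sup>2"
    by (intro mult_right_mono hardy_coefficient_small) (use n c in auto)
  moreover have "?w * (c / (real n - 1 + c)) * (u n)\<^sup>2
      - (real (n - 1) + 1) powr (1 - 2*c) * (c / real (n - 1)) * (u (n - 1))\<^sup>2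
      \<le> ?w * (u n - u (n - 1))\<^sup>2"
  proof (cases "n = 1")
    \<comment> \<open>The ratio \<open>q 1\<close> is undefined, but with \<open>u 0 = 0\<close> and
      \<open>c / (1 - 1 + c) = 1\<close> the claim is an equality.\<close>
    case True
    then show ?thesis using u0 c by simp
  next
    case False
    then have n2: "real n > 1" using n by simp
    define q where "q = (real n - 1 + c) / (real n - 1)"
    have "q > 0" using n2 c by (simp add: q_def)
    have q: "1 - 1 / q = c / (real n - 1 + c)" "1 - q = - (c / (real n - 1))"
      using n2 c by (simp_all add: q_def field_simps)
    have "?w * ((1 - 1 / q) * (u n)\<^sup>2 + (1 - q) * (u (n - 1))\<^sup>2) \<le> ?w * (u n - u (n - 1))\<^sup>2"
      by (intro mult_left_mono square_diff_ge_weighted \<open>q > 0\<close>) auto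
    then show ?thesis
      unfolding q using n by (simp add: of_nat_diff algebra_simps)
  qed
  ultimately show "(c\<^sup>2 * (?w / (real n)\<^sup>2) + (real n + 1) powr (1 - 2*c) * (c / real n)) * (u n)\<^sup>2
      - (real (n - 1) + 1) powr (1 - 2*c) * (c / real (n - 1)) * (u (n - 1))\<^sup>2
      \<le> ?w * (u n - u (n - 1))\<^sup>2"
    by (rule order_trans[OF diff_right_mono])
qed

lemma hardy_large:
  fixes u :: "nat \<Rightarrow> real"
  assumes fin: "finite {n. u n \<noteq> 0}" and u0: "u 0 = 0" and b: "1 \<le> b"
  shows "(\<Sum>\<^sub>\<infinity>n\<in>{1..}. real n powr (1 + 2*b) * (u n - u (n - 1))\<^sup>2)
    \<ge> (\<Sum>\<^sub>\<infinity>n\<in>{1..}. b\<^sup>2 * (real n powr (1 + 2*b) / (real n)\<^sup>2) * (u n)\<^sup>2)"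
\<comment> \<open>Since \<open>q < 1\<close>, the term in \<open>u (n - 1)\<close> is now a gain,
  hence the negative potential. The denominator \<open>n + b\<close> is positive at
  \<open>n = 1\<close>, so no separate first step arises.\<close>
proof (rule infsum_le_of_telescoping[OF fin u0,
    where p = "\<lambda>n. - ((real n + 1) powr (1 + 2*b) * (b / (real n + 1 + b)))"])
  fix n :: nat assume n: "n \<ge> 1"
  let ?w = "real n powr (1 + 2*b)"
  have combine: "(h + - P) * U - - Q * V \<le> W" if "(h + w) * U \<le> P * U" "- w * U + Q * V \<le> W"
    for h w P Q U V W :: real
    using that by (simp add: algebra_simps)
  have "(b\<^sup>2 * (?w / (real n)\<^sup>2) + ?w * (b / real n)) * (u n)\<^sup>2
      \<le> (real n + 1) powr (1 + 2*b) * (b / (real n + 1 + b)) * (u n)\<^sup>2"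
    by (intro mult_right_mono hardy_coefficient_large) (use n b in auto)
  moreover have "- (?w * (b / real n)) * (u n)\<^sup>2
      + (real (n - 1) + 1) powr (1 + 2*b) * (b / (real (n - 1) + 1 + b)) * (u (n - 1))\<^sup>2
      \<le> ?w * (u n - u (n - 1))\<^sup>2"
  proof -
    define q where "q = real n / (real n + b)"
    have "q > 0" using n b by (simp add: q_def)
    have q: "1 - 1 / q = - (b / real n)" "1 - q = b / (real n + b)"
      using n b by (simp_all add: q_def field_simps)
    have "?w * ((1 - 1 / q) * (u n)\<^sup>2 + (1 - q) * (u (n - 1))\<^sup>2) \<le> ?w * (u n - u (n - 1))\<^sup>2"
      by (intro mult_left_mono square_diff_ge_weighted \<open>q > 0\<close>) auto
    then show ?thesis
      unfolding q using n by (simp add: of_nat_diff algebra_simps)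
  qed
  ultimately show "(b\<^sup>2 * (?w / (real n)\<^sup>2) + - ((real n + 1) powr (1 + 2*b) * (b / (real n + 1 + b)))) * (u n)\<^sup>2
      - - ((real (n - 1) + 1) powr (1 + 2*b) * (b / (real (n - 1) + 1 + b))) * (u (n - 1))\<^sup>2
      \<le> ?w * (u n - u (n - 1))\<^sup>2"
    using combine by blast
qed

section \<open>Sharpness of the constant\<close>

text \<open>The increment of \<open>n powr c\<close> behaves like \<open>c * n powr (c - 1)\<close>.
  With weight \<open>n powr (1 - 2*c)\<close> the energy terms are thus close to
  \<open>c\<^sup>2 / n\<close>; the extra factor \<open>n\<close> in the exponent
  \<open>2 - 2*c\<close> normalises them.\<close>

lemma tendsto_scaled_powr_increment:
  fixes c :: real
  shows "(\<lambda>n::nat. real n powr (2 - 2*c) * (real n powr c - real (n - 1) powr c)\<^sup>2) \<longlonglongrightarrow> c\<^sup>2"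
proof -
  have "(\<lambda>n::nat. real n * (1 - (1 - 1 / real n) powr c)) \<longlonglongrightarrow> c"
    by real_asymp
  then have "(\<lambda>n::nat. (real n * (1 - (1 - 1 / real n) powr c))\<^sup>2) \<longlonglongrightarrow> c\<^sup>2"
    by (intro tendsto_intros)
  moreover have "\<forall>\<^sub>F n::nat in sequentially. (real n * (1 - (1 - 1 / real n) powr c))\<^sup>2
      = real n powr (2 - 2*c) * (real n powr c - real (n - 1) powr c)\<^sup>2"
    using eventually_gt_at_top[of "1::nat"]
  proof eventually_elim
    case (elim n)
    have "real (n - 1) = real n * (1 - 1 / real n)"
      using elim by (simp add: field_simps of_nat_diff)
    then have "real (n - 1) powr c = real n powr c * (1 - 1 / real n) powr c"
      using elim by (simp add: powr_mult)
    then have "real n powr (2 - 2*c) * (real n powr c - real (n - 1) powr c)\<^sup>2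
        = real n powr (2 - 2*c) * (real n powr c)\<^sup>2 * (1 - (1 - 1 / real n) powr c)\<^sup>2"
      by (simp add: power2_eq_square algebra_simps)
    also have "real n powr (2 - 2*c) * (real n powr c)\<^sup>2 = (real n)\<^sup>2"
      using elim by (simp add: power2_eq_square flip: powr_add)
    finally show ?case by (simp add: power_mult_distrib)
  qed
  ultimately show ?thesis by (rule Lim_transform_eventually)
qed

text \<open>At \<open>n = 0\<close> the convention \<open>0 powr c = 0\<close> supplies the boundary
  value for every \<open>c\<close>, negative ones included. The power and the linear piece agree at
  \<open>N\<close>.\<close>

definition cutoff :: "real \<Rightarrow> nat \<Rightarrow> nat \<Rightarrow> real" where
  "cutoff c N n = (if n \<le> N then real n powr c
     else if n \<le> 2 * N then real N powr c * (2 - real n / real N) else 0)"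

lemma cutoff_0 [simp]: "cutoff c N 0 = 0"
  by (simp add: cutoff_def)

lemma cutoff_eq_0: "cutoff c N n = 0" if "N \<ge> 1" "n \<ge> 2 * N"
  using that by (cases "n = 2 * N") (auto simp: cutoff_def)

lemma finite_support_cutoff: "finite {n. cutoff c N n \<noteq> 0}"
  by (rule finite_subset[of _ "{..2*N}"]) (auto simp: cutoff_def split: if_splits)

text \<open>There are \<open>N\<close> steps of size \<open>N powr (c - 1)\<close>, each with weight
  at most \<open>(2 * N) powr (1 - 2*c)\<close>, so the powers of \<open>N\<close> cancel and the
  bound is uniform in \<open>N\<close>.\<close>

lemma cutoff_tail_energy:
  assumes N: "N \<ge> 1" and c: "c \<le> 1/2"
  shows "(\<Sum>n=N+1..2*N. real n powr (1 - 2*c) * (cutoff c N n - cutoff c N (n - 1))\<^sup>2)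
    \<le> 2 powr (1 - 2*c)"
proof -
  have "(\<Sum>n=N+1..2*N. real n powr (1 - 2*c) * (cutoff c N n - cutoff c N (n - 1))\<^sup>2)
      \<le> of_nat (card {N+1..2*N}) * (2 powr (1 - 2*c) / real N)"
  proof (rule sum_bounded_above)
    fix n assume n: "n \<in> {N+1..2*N}"
    have "cutoff c N n - cutoff c N (n - 1) = - (real N powr c / real N)"
      using n N by (cases "n = N + 1") (auto simp: cutoff_def field_simps of_nat_diff)
    then have "real n powr (1 - 2*c) * (cutoff c N n - cutoff c N (n - 1))\<^sup>2
        = real n powr (1 - 2*c) * ((real N powr c)\<^sup>2 / (real N)\<^sup>2)"
      by (simp add: power_divide)
    also have "\<dots> \<le> (2 * real N) powr (1 - 2*c) * ((real N powr c)\<^sup>2 / (real N)\<^sup>2)"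
      using n c by (intro mult_right_mono powr_mono2) auto
    also have "\<dots> = 2 powr (1 - 2*c) * (real N powr (1 - 2*c) * (real N powr c)\<^sup>2) / (real N)\<^sup>2"
      using N by (simp add: powr_mult)
    also have "real N powr (1 - 2*c) * (real N powr c)\<^sup>2 = real N"
      using N by (simp add: power2_eq_square flip: powr_add)
    finally show "real n powr (1 - 2*c) * (cutoff c N n - cutoff c N (n - 1))\<^sup>2
        \<le> 2 powr (1 - 2*c) / real N"
      using N by (simp add: power2_eq_square)
  qed
  then show ?thesis using N by simp
qed

text \<open>From some index \<open>m\<close> on, each term is at most
  \<open>(c\<^sup>2 + e) / n\<close>. The earlier terms are collected in \<open>K\<close>, which
  does not depend on \<open>N\<close>.\<close>

lemma cutoff_head_energy:
  fixes c e :: real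
  assumes "e > 0"
  obtains K where "\<And>N. (\<Sum>n=1..N. real n powr (1 - 2*c) * (cutoff c N n - cutoff c N (n - 1))\<^sup>2)
    \<le> K + (c\<^sup>2 + e) * harm N"
proof -
  define f where "f n = real n powr (1 - 2*c) * (real n powr c - real (n - 1) powr c)\<^sup>2" for n
  have "\<forall>\<^sub>F n::nat in sequentially. real n powr (2 - 2*c) * (real n powr c - real (n - 1) powr c)\<^sup>2 < c\<^sup>2 + e"
    using tendsto_scaled_powr_increment by (rule order_tendstoD) (use assms in simp)
  then obtain m where m: "\<And>n. n \<ge> m \<Longrightarrow>
      real n powr (2 - 2*c) * (real n powr c - real (n - 1) powr c)\<^sup>2 < c\<^sup>2 + e"
    unfolding eventually_sequentially by blast
  have f: "f n \<le> (c\<^sup>2 + e) * inverse (real n)" if "n \<ge> m" "n \<ge> 1" for n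
  proof -
    have "real n powr (2 - 2*c) = real n * real n powr (1 - 2*c)"
      using that by (subst powr_mult_base) auto
    then have "f n * real n \<le> c\<^sup>2 + e" using m[OF that(1)] by (simp add: f_def mult_ac)
    then show ?thesis using that by (simp add: field_simps)
  qed
  have "(\<Sum>n=1..N. f n) \<le> (\<Sum>n=1..m. f n) + (c\<^sup>2 + e) * harm N" for N
  proof -
    \<comment> \<open>Enlarging the index set covers \<open>N < m\<close> as well; the overlap at
      \<open>m\<close> is harmless because the terms are nonnegative.\<close>
    have "(\<Sum>n=1..N. f n) \<le> (\<Sum>n\<in>{1..m} \<union> {n\<in>{1..N}. n \<ge> m}. f n)"
      by (rule sum_mono2) (auto simp: f_def)
    also have "\<dots> \<le> (\<Sum>n=1..m. f n) + (\<Sum>n\<in>{n\<in>{1..N}. n \<ge> m}. f n)"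
      by (subst sum_Un) (auto simp: f_def intro!: sum_nonneg)
    also have "(\<Sum>n\<in>{n\<in>{1..N}. n \<ge> m}. f n) \<le> (\<Sum>n\<in>{n\<in>{1..N}. n \<ge> m}. (c\<^sup>2 + e) * inverse (real n))"
      by (rule sum_mono) (use f in auto)
    also have "\<dots> \<le> (\<Sum>n=1..N. (c\<^sup>2 + e) * inverse (real n))"
      by (rule sum_mono2) (use assms in auto)
    also have "\<dots> = (c\<^sup>2 + e) * harm N" by (simp add: harm_def sum_distrib_left)
    finally show ?thesis by simp
  qed
  moreover have "(\<Sum>n=1..N. real n powr (1 - 2*c) * (cutoff c N n - cutoff c N (n - 1))\<^sup>2)
      = (\<Sum>n=1..N. f n)" for N
    by (rule sum.cong) (auto simp: cutoff_def f_def)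
  ultimately show ?thesis using that by metis
qed

text \<open>Up to \<open>N\<close> the summand is exactly \<open>1 / n\<close>; the linear piece
  only adds nonnegative terms.\<close>

lemma cutoff_mass:
  "(\<Sum>n=1..2*N. (cutoff c N n)\<^sup>2 / (real n)\<^sup>2 * real n powr (1 - 2*c)) \<ge> harm N"
proof -
  have "(harm N :: real) = (\<Sum>n=1..N. (cutoff c N n)\<^sup>2 / (real n)\<^sup>2 * real n powr (1 - 2*c))"
    unfolding harm_def
  proof (rule sum.cong)
    fix n assume n: "n \<in> {1..N}"
    have "(real n powr c)\<^sup>2 * real n powr (1 - 2*c) = real n"
      using n by (simp add: power2_eq_square flip: powr_add)
    then show "inverse (of_nat n) = (cutoff c N n)\<^sup>2 / (real n)\<^sup>2 * real n powr (1 - 2*c)"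
      using n by (simp add: cutoff_def field_simps power2_eq_square)
  qed simp
  also have "\<dots> \<le> (\<Sum>n=1..2*N. (cutoff c N n)\<^sup>2 / (real n)\<^sup>2 * real n powr (1 - 2*c))"
    by (rule sum_mono2) auto
  finally show ?thesis .
qed

lemma hardy_constant_sharp:
  fixes c C :: real
  assumes c: "c \<le> 1/2" and C: "C > c\<^sup>2"
  shows "\<exists>u :: nat \<Rightarrow> real. finite {n. u n \<noteq> 0} \<and> u 0 = 0 \<and>
    (\<Sum>\<^sub>\<infinity>n\<in>{1..}. real n powr (1 - 2*c) * (u n - u (n - 1))\<^sup>2)
      < C * (\<Sum>\<^sub>\<infinity>n\<in>{1..}. (u n)\<^sup>2 / (real n)\<^sup>2 * real n powr (1 - 2*c))"
proof -
  \<comment> \<open>Half of the gap absorbs the error in the energy rate; the other half, multiplied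
    by \<open>harm N\<close>, has to exceed the bounded cost \<open>K + 2 powr (1 - 2*c)\<close>,
    which fixes \<open>N\<close>.\<close>
  define e where "e = (C - c\<^sup>2) / 2"
  have e: "e > 0" "C = c\<^sup>2 + e + e" using C by (auto simp: e_def field_simps)
  obtain K where K: "\<And>N. (\<Sum>n=1..N. real n powr (1 - 2*c) * (cutoff c N n - cutoff c N (n - 1))\<^sup>2)
      \<le> K + (c\<^sup>2 + e) * harm N"
    using cutoff_head_energy e(1) by blast
  have "\<forall>\<^sub>F N in sequentially. (harm N :: real) > (K + 2 powr (1 - 2*c)) / e"
    using harm_at_top by (simp add: filterlim_at_top_dense)
  then obtain N where N: "N \<ge> 1" "(harm N :: real) > (K + 2 powr (1 - 2*c)) / e"
    using eventually_conj[OF eventually_ge_at_top[of "1::nat"]] eventually_happens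
    by (metis (no_types, lifting) sequentially_bot)
  let ?u = "cutoff c N"
  define E where "E = (\<Sum>\<^sub>\<infinity>n\<in>{1..}. real n powr (1 - 2*c) * (?u n - ?u (n - 1))\<^sup>2)"
  define S where "S = (\<Sum>\<^sub>\<infinity>n\<in>{1..}. (?u n)\<^sup>2 / (real n)\<^sup>2 * real n powr (1 - 2*c))"
  have "E = (\<Sum>n=1..2*N. real n powr (1 - 2*c) * (?u n - ?u (n - 1))\<^sup>2)"
    \<comment> \<open>The term at \<open>2 * N + 1\<close> still involves the value at
      \<open>2 * N\<close>, which is zero too.\<close>
    unfolding E_def by (rule infsum_atLeast1_eq_sum) (use N(1) in \<open>simp add: cutoff_eq_0\<close>)
  also have "{1..2*N} = {1..N} \<union> {N+1..2*N}" by auto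
  also have "(\<Sum>n\<in>{1..N} \<union> {N+1..2*N}. real n powr (1 - 2*c) * (?u n - ?u (n - 1))\<^sup>2)
      = (\<Sum>n=1..N. real n powr (1 - 2*c) * (?u n - ?u (n - 1))\<^sup>2)
        + (\<Sum>n=N+1..2*N. real n powr (1 - 2*c) * (?u n - ?u (n - 1))\<^sup>2)"
    by (rule sum.union_disjoint) auto
  also have "\<dots> \<le> K + (c\<^sup>2 + e) * harm N + 2 powr (1 - 2*c)"
    by (intro add_mono K cutoff_tail_energy N(1) c)
  also have "\<dots> < C * harm N"
    using N(2) e by (simp add: field_simps)
  also have "harm N \<le> S"
  proof -
    have "S = (\<Sum>n=1..2*N. (?u n)\<^sup>2 / (real n)\<^sup>2 * real n powr (1 - 2*c))"
      unfolding S_def by (rule infsum_atLeast1_eq_sum) (simp add: cutoff_def)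
    then show ?thesis using cutoff_mass by simp
  qed
  then have "C * harm N \<le> C * S"
    using C by (intro mult_left_mono) (auto intro: order_trans[OF zero_le_power2 less_imp_le])
  finally have "E < C * S" .
  then show ?thesis
    using finite_support_cutoff[of c N] unfolding E_def S_def by (intro exI[of _ ?u]) simp
qed

theorem corollary2p1:
  fixes \<alpha> :: real
  assumes "\<alpha> \<in> {0..<1} \<union> {5..}"
  shows "(\<forall>u :: nat \<Rightarrow> real. finite {n. u n \<noteq> 0} \<and> u 0 = 0 \<longrightarrow>
            (\<Sum>\<^sub>\<infinity>n\<in>{1..}. \<bar>u n - u (n - 1)\<bar>\<^sup>2 * real n powr \<alpha>)
              \<ge> (\<alpha> - 1)\<^sup>2 / 4 * (\<Sum>\<^sub>\<infinity>n\<in>{1..}. \<bar>u n\<bar>\<^sup>2 / (real n)\<^sup>2 * real n powr \<alpha>))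
       \<and> (\<forall>C :: real. C > (\<alpha> - 1)\<^sup>2 / 4 \<longrightarrow>
            (\<exists>u :: nat \<Rightarrow> real. finite {n. u n \<noteq> 0} \<and> u 0 = 0 \<and>
              \<not> ((\<Sum>\<^sub>\<infinity>n\<in>{1..}. \<bar>u n - u (n - 1)\<bar>\<^sup>2 * real n powr \<alpha>)
                   \<ge> C * (\<Sum>\<^sub>\<infinity>n\<in>{1..}. \<bar>u n\<bar>\<^sup>2 / (real n)\<^sup>2 * real n powr \<alpha>))))"
proof -
  define c where "c = (1 - \<alpha>) / 2"
  have \<alpha>: "\<alpha> = 1 - 2 * c" and const: "(\<alpha> - 1)\<^sup>2 / 4 = c\<^sup>2"
    by (simp_all add: c_def power2_eq_square field_simps)
  have energy: "(\<Sum>\<^sub>\<infinity>n\<in>{1..}. \<bar>u n - u (n - 1)\<bar>\<^sup>2 * real n powr \<alpha>)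
      = (\<Sum>\<^sub>\<infinity>n\<in>{1..}. real n powr (1 - 2*c) * (u n - u (n - 1))\<^sup>2)" for u :: "nat \<Rightarrow> real"
    by (simp add: \<alpha> mult.commute)
  have mass: "k * (\<Sum>\<^sub>\<infinity>n\<in>{1..}. \<bar>u n\<bar>\<^sup>2 / (real n)\<^sup>2 * real n powr \<alpha>)
      = (\<Sum>\<^sub>\<infinity>n\<in>{1..}. k * (real n powr (1 - 2*c) / (real n)\<^sup>2) * (u n)\<^sup>2)"
    for u :: "nat \<Rightarrow> real" and k :: real
    by (simp add: \<alpha> mult_ac flip: infsum_cmult_right')
  have "(\<Sum>\<^sub>\<infinity>n\<in>{1..}. c\<^sup>2 * (real n powr (1 - 2*c) / (real n)\<^sup>2) * (u n)\<^sup>2)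
      \<le> (\<Sum>\<^sub>\<infinity>n\<in>{1..}. real n powr (1 - 2*c) * (u n - u (n - 1))\<^sup>2)"
    if u: "finite {n. u n \<noteq> 0}" "u 0 = 0" for u :: "nat \<Rightarrow> real"
  \<comment> \<open>For \<alpha> below 1, \<open>c\<close> lies in (0, 1/2]. Otherwise \<alpha> is
    at least 5, and \<open>b = - c\<close> is at least 2.\<close>
  proof (cases "\<alpha> < 1")
    case True
    then show ?thesis using hardy_small[OF u, of c] assms by (auto simp: c_def)
  next
    case False
    then show ?thesis using hardy_large[OF u, of "- c"] assms by (auto simp: c_def)
  qed
  moreover have "c \<le> 1/2" using assms by (auto simp: c_def)
  ultimately show ?thesis
    unfolding const mass[of "c\<^sup>2"] energy
    using hardy_constant_sharp[of c] by (auto simp: \<alpha> not_le)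
qed

end
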